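(* Let $(C,Z,\models)$ and $(C',Z,\models')$ be concept-class triples with the same observation set $Z$ such that $C\subseteq C'$ and, for all $c\in C$ and $z\in Z$, $c\models z$ if and only if $c\models' z$. Then for each sampling mode $(\alpha,\beta)\in\{O,\overline{O}\}\times\{R,\overline{R}\}$, $$\mathrm{MAP\text{-}TD}^{\alpha,\beta}(C,Z,\models)\ \le\ \mathrm{MAP\text{-}TD}^{\alpha,\beta}(C',Z,\models').$$
   Context: A concept-class triple $(C,Z,\models)$ consists of a finite set $C$ with $|C|\ge 2$ (the concept class), a non-empty finite set $Z$ (the observations) and a relation $\models$ on $C\times Z$ (consistency). Sampling modes are pairs $(\alpha,\beta)\in\{O,\overline{O}\}\times\{R,\overline{R}\}$ (ordered/unordered, with/without replacement). $\mathcal{Z}^{O,R}$ is the set of finite sequences over $Z$; $\mathcal{Z}^{\overline{O},R}$ the set of finite multisets over $Z$; $\mathcal{Z}^{O,\overline{R}}$ the set of repetition-free sequences over $Z$; $\mathcal{Z}^{\overline{O},\overline{R}}=2^Z$. The empty sequence/multiset/set is included and denoted $\emptyset$; $|I|$ is the length of a sequence or the cardinality (with multiplicity) of a (multi)set. For a probability vector $Q=(q(z))_{z\in Z}$: $P^{O,R}((z_1,\dots,z_n)|Q)=\prod_{i=1}^n q(z_i)$; for a multiset $A$ of size $n$ with distinct elements $z'_1,\dots,z'_k$ of multiplicities $n_1,\dots,n_k$, $P^{\overline{O},R}(A|Q)=\frac{n!}{n_1!\cdots n_k!}\prod_{i=1}^k q(z'_i)^{n_i}$; for a repetition-free sequence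 with $n\le|\{z:q(z)>0\}|$, $P^{O,\overline{R}}((z_1,\dots,z_n)|Q)=\prod_{i=1}^n \frac{q(z_i)}{1-(q(z_1)+\dots+q(z_{i-1}))}$; for a set $A=\{z_1,\dots,z_n\}$ of size $n\le|\{z:q(z)>0\}|$, $P^{\overline{O},\overline{R}}(A|Q)=\sum_\sigma P^{O,\overline{R}}((z_{\sigma(1)},\dots,z_{\sigma(n)})|Q)$ over all permutations $\sigma$ of $\{1,\dots,n\}$. The probability of $\emptyset$ is $1$ in every mode. A MAP-learner $L$ for $(C,Z,\models)$ is given by priors $P(c)>0$ with $\sum_{c\in C}P(c)=1$ and conditional likelihoods $P(z|c)\ge 0$ with $\sum_{z\in Z}P(z|c)=1$ for each $c\in C$, subject to the validity condition: $c\not\models z$ implies $P(z|c)=0$. Write $P^{\alpha,\beta}(I|c)$ for $P^{\alpha,\beta}(I|P(\cdot|c))$ and $N^+(C,L)=\min_{c\in C}|\{z\in Z:P(z|c)>0\}|$. A teacher for $L$ in mode $(\alpha,\beta)$ is a map $T:C\to\mathcal{Z}^{\alpha,\beta}$ such that for every $c_0\in C$: if $\beta=\overline{R}$ then $|T(c_0)|\le N^+(C,L)$; and $c_0$ is the unique maximizer over $c\in C$ of $P(c)\cdot P^{\alpha,\beta}(T(c_0)|c)$. The order of $T$ is $\max_{c\in C}|T(c)|$. $\mathrm{MAP\text{-}TD}^{\alpha,\beta}_L(C,Z,\models)$ is the smallest order of a teacher for $L$ in mode $(\alpha,\beta)$, or $\infty$ if no teacher exists. $\mathrm{MAP\text{-}TD}^{\alpha,\beta}(C,Z,\models)=\min_L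 \mathrm{MAP\text{-}TD}^{\alpha,\beta}_L(C,Z,\models)$ with $L$ ranging over all MAP-learners for $(C,Z,\models)$. *)

theory Defs
  imports Complex_Main "HOL-Library.Multiset" "HOL-Library.Extended_Nat"
    "HOL-Combinatorics.Multiset_Permutations"
begin

text \<open>A consistency relation is a curried predicate; only its values on
  \<open>C \<times> Z\<close> are ever used.\<close>

definition concept_class_triple :: "'c set \<Rightarrow> 'z set \<Rightarrow> ('c \<Rightarrow> 'z \<Rightarrow> bool) \<Rightarrow> bool" where
  "concept_class_triple C Z sat \<longleftrightarrow> finite C \<and> card C \<ge> 2 \<and> finite Z \<and> Z \<noteq> {}"

datatype order_mode = Ordered | Unordered

datatype repl_mode = With_Repl | Without_Repl

text \<open>One type hosts the samples of all four modes; which constructor occurs in which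
  mode is fixed by \<open>samples\<close>.\<close>

datatype 'z sample = Seq_Sample "'z list" | Multiset_Sample "'z multiset" | Set_Sample "'z set"

fun samples :: "order_mode \<Rightarrow> repl_mode \<Rightarrow> 'z set \<Rightarrow> 'z sample set" where
  "samples Ordered With_Repl Z = Seq_Sample ` {zs. set zs \<subseteq> Z}"
| "samples Unordered With_Repl Z = Multiset_Sample ` {A. set_mset A \<subseteq> Z}"
| "samples Ordered Without_Repl Z = Seq_Sample ` {zs. set zs \<subseteq> Z \<and> distinct zs}"
| "samples Unordered Without_Repl Z = Set_Sample ` Pow Z"

fun sample_size :: "'z sample \<Rightarrow> nat" where
  "sample_size (Seq_Sample zs) = length zs"
| "sample_size (Multiset_Sample A) = size A"
| "sample_size (Set_Sample A) = card A"

definition seq_prob_without_repl :: "('z \<Rightarrow> real) \<Rightarrow> 'z list \<Rightarrow> real" where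
  "seq_prob_without_repl q zs =
     (\<Prod>i<length zs. q (zs ! i) / (1 - (\<Sum>j<i. q (zs ! j))))"

text \<open>Without replacement, the value is meaningful only if the sample size does not exceed
  the number of observations of positive probability (otherwise a denominator may vanish);
  \<open>is_teacher\<close> below enforces this bound wherever the value is used.
  The combinations without an equation (sets with replacement, multisets without) are not
  samples of any mode.\<close>

fun sample_prob :: "repl_mode \<Rightarrow> ('z \<Rightarrow> real) \<Rightarrow> 'z sample \<Rightarrow> real" where
  "sample_prob With_Repl q (Seq_Sample zs) = (\<Prod>i<length zs. q (zs ! i))"
| "sample_prob With_Repl q (Multiset_Sample A) =
     fact (size A) / (\<Prod>z\<in>set_mset A. fact (count A z)) * (\<Prod>z\<in>set_mset A. q z ^ count A z)"
| "sample_prob Without_Repl q (Seq_Sample zs) = seq_prob_without_repl q zs"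
| "sample_prob Without_Repl q (Set_Sample A) =
     (\<Sum>zs\<in>permutations_of_set A. seq_prob_without_repl q zs)"

record ('c, 'z) learner =
  prior :: "'c \<Rightarrow> real"
  likelihood :: "'c \<Rightarrow> 'z \<Rightarrow> real"  \<comment> \<open>\<open>likelihood L c z\<close> is \<open>P(z|c)\<close>\<close>

definition MAP_learner ::
  "'c set \<Rightarrow> 'z set \<Rightarrow> ('c \<Rightarrow> 'z \<Rightarrow> bool) \<Rightarrow> ('c, 'z) learner \<Rightarrow> bool" where
  "MAP_learner C Z sat L \<longleftrightarrow>
     (\<forall>c\<in>C. prior L c > 0) \<and> (\<Sum>c\<in>C. prior L c) = 1 \<and>
     (\<forall>c\<in>C. (\<forall>z\<in>Z. likelihood L c z \<ge> 0) \<and> (\<Sum>z\<in>Z. likelihood L c z) = 1) \<and>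
     (\<forall>c\<in>C. \<forall>z\<in>Z. \<not> sat c z \<longrightarrow> likelihood L c z = 0)"

definition N_plus :: "'c set \<Rightarrow> 'z set \<Rightarrow> ('c, 'z) learner \<Rightarrow> nat" where
  "N_plus C Z L = (MIN c\<in>C. card {z\<in>Z. likelihood L c z > 0})"

definition is_teacher :: "order_mode \<Rightarrow> repl_mode \<Rightarrow> 'c set \<Rightarrow> 'z set \<Rightarrow>
    ('c, 'z) learner \<Rightarrow> ('c \<Rightarrow> 'z sample) \<Rightarrow> bool" where
  "is_teacher \<alpha> \<beta> C Z L T \<longleftrightarrow>
     (\<forall>c\<^sub>0\<in>C. T c\<^sub>0 \<in> samples \<alpha> \<beta> Z \<and>
        (\<beta> = Without_Repl \<longrightarrow> sample_size (T c\<^sub>0) \<le> N_plus C Z L) \<and>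
        {c. is_arg_max (\<lambda>c. prior L c * sample_prob \<beta> (likelihood L c) (T c\<^sub>0))
              (\<lambda>c. c \<in> C) c} = {c\<^sub>0})"

definition teacher_order :: "'c set \<Rightarrow> ('c \<Rightarrow> 'z sample) \<Rightarrow> nat" where
  "teacher_order C T = (MAX c\<in>C. sample_size (T c))"

text \<open>The infimum of a set of extended naturals is its least element, or \<open>\<infinity>\<close> if
  the set is empty. In particular \<open>MAP_TD\<close> is \<open>\<infinity>\<close> if there is no MAP-learner at all,
  i.e. if some concept is consistent with no observation.\<close>

definition MAP_TD_learner :: "order_mode \<Rightarrow> repl_mode \<Rightarrow> 'c set \<Rightarrow> 'z set \<Rightarrow>
    ('c, 'z) learner \<Rightarrow> enat" where
  "MAP_TD_learner \<alpha> \<beta> C Z L =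
     (INF T\<in>{T. is_teacher \<alpha> \<beta> C Z L T}. enat (teacher_order C T))"

definition MAP_TD :: "order_mode \<Rightarrow> repl_mode \<Rightarrow> 'c set \<Rightarrow> 'z set \<Rightarrow>
    ('c \<Rightarrow> 'z \<Rightarrow> bool) \<Rightarrow> enat" where
  "MAP_TD \<alpha> \<beta> C Z sat = (INF L\<in>{L. MAP_learner C Z sat L}. MAP_TD_learner \<alpha> \<beta> C Z L)"

end

theory Submission
  imports Defs
begin

text \<open>Restrict a learner for \<open>C'\<close> to \<open>C\<close>, renormalizing the priors and keeping the
  likelihoods. Scaling all priors by one constant does not affect maximizers, a unique maximizer
  over \<open>C'\<close> that lies in \<open>C\<close> is the unique maximizer over \<open>C\<close>, and the minimum \<open>N\<^sup>+\<close> can only grow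
  on a smaller class. So every teacher for \<open>C'\<close> is still a teacher for \<open>C\<close>, of no larger order.\<close>

definition restrict_learner :: "'c set \<Rightarrow> ('c, 'z) learner \<Rightarrow> ('c, 'z) learner" where
  "restrict_learner C L = L\<lparr>prior := \<lambda>c. prior L c / (\<Sum>d\<in>C. prior L d)\<rparr>"

lemma prior_restrict_learner [simp]:
  "prior (restrict_learner C L) c = prior L c / (\<Sum>d\<in>C. prior L d)"
  by (simp add: restrict_learner_def)

lemma likelihood_restrict_learner [simp]:
  "likelihood (restrict_learner C L) = likelihood L"
  by (simp add: restrict_learner_def)

text \<open>A nonempty sum of positive priors. As a positive divisor, it keeps the priors positive
  and preserves comparisons between posterior weights.\<close>

lemma sum_prior_pos:
  assumes "MAP_learner C' Z sat L" "finite C'" "C \<subseteq> C'" "C \<noteq> {}"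
  shows "(\<Sum>c\<in>C. prior L c) > 0"
  using assms by (intro sum_pos) (auto simp: MAP_learner_def dest: finite_subset)

lemma MAP_learner_restrict_learner:
  assumes L: "MAP_learner C' Z sat' L"
    and C: "finite C'" "C \<subseteq> C'" "C \<noteq> {}"
    and sat: "\<And>c z. c \<in> C \<Longrightarrow> z \<in> Z \<Longrightarrow> sat c z \<longleftrightarrow> sat' c z"
  shows "MAP_learner C Z sat (restrict_learner C L)"
  \<comment> \<open>Reversed, \<open>sum_divide_distrib\<close> gathers the rescaled priors into one
    fraction with equal numerator and denominator.\<close>
  using L C sat sum_prior_pos[OF L C]
  by (auto simp: MAP_learner_def simp flip: sum_divide_distrib)

text \<open>The minimum ranges over fewer concepts. This preserves the size bound on samples drawn
  without replacement.\<close>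

lemma N_plus_antimono:
  assumes "finite C'" "C \<subseteq> C'" "C \<noteq> {}"
  shows "N_plus C' Z L \<le> N_plus C Z L"
  unfolding N_plus_def using assms by (intro Min_antimono) auto

lemma teacher_order_mono:
  assumes "finite C'" "C \<subseteq> C'" "C \<noteq> {}"
  shows "teacher_order C T \<le> teacher_order C' T"
  unfolding teacher_order_def using assms by (intro Max_mono) auto

text \<open>If \<open>x\<close> maximizes over \<open>A\<close>, then \<open>f x\<close> is at least
  \<open>f a\<close>, the maximum over \<open>B\<close>; so \<open>x\<close> maximizes over
  \<open>B\<close> too and equals \<open>a\<close>.\<close>

lemma unique_arg_max_subset:
  fixes f :: "'a \<Rightarrow> 'b::linorder"
  assumes max: "{x. is_arg_max f (\<lambda>x. x \<in> B) x} = {a}" and "A \<subseteq> B" "a \<in> A"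
  shows "{x. is_arg_max f (\<lambda>x. x \<in> A) x} = {a}"
proof -
  have B: "is_arg_max f (\<lambda>x. x \<in> B) x \<longleftrightarrow> x = a" for x
    using max by blast
  have le: "f y \<le> f a" if "y \<in> B" for y
    using B[of a] that by (simp add: is_arg_max_linorder)
  have "is_arg_max f (\<lambda>x. x \<in> A) x \<longleftrightarrow> x = a" for x
  proof
    assume x: "is_arg_max f (\<lambda>x. x \<in> A) x"
    then have "f a \<le> f x" "x \<in> B"
      using assms(2,3) by (auto simp: is_arg_max_linorder)
    with le have "is_arg_max f (\<lambda>x. x \<in> B) x"
      by (auto simp: is_arg_max_linorder intro: order_trans)
    with B show "x = a" by blast
  next
    assume "x = a"
    with le assms(2,3) show "is_arg_max f (\<lambda>x. x \<in> A) x"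
      by (auto simp: is_arg_max_linorder)
  qed
  then show ?thesis by simp
qed

lemma is_arg_max_divide_pos:
  fixes f :: "'a \<Rightarrow> real"
  assumes "s > 0"
  shows "is_arg_max (\<lambda>x. f x / s) P = is_arg_max f P"
  using assms by (auto simp: fun_eq_iff is_arg_max_linorder divide_le_cancel)

lemma is_teacher_restrict_learner:
  assumes L: "MAP_learner C' Z sat L"
    and T: "is_teacher \<alpha> \<beta> C' Z L T"
    and C: "finite C'" "C \<subseteq> C'" "C \<noteq> {}"
  shows "is_teacher \<alpha> \<beta> C Z (restrict_learner C L) T"
  unfolding is_teacher_def
proof (intro ballI conjI impI)
  fix c\<^sub>0 assume c0: "c\<^sub>0 \<in> C"
  then have c0': "c\<^sub>0 \<in> C'" using C by auto
  show "T c\<^sub>0 \<in> samples \<alpha> \<beta> Z"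
    using T c0' by (auto simp: is_teacher_def)
  \<comment> \<open>\<open>N_plus\<close> depends on the likelihoods alone, which restriction
    keeps.\<close>
  have N: "N_plus C Z (restrict_learner C L) = N_plus C Z L"
    by (simp add: N_plus_def)
  show "sample_size (T c\<^sub>0) \<le> N_plus C Z (restrict_learner C L)" if "\<beta> = Without_Repl"
    using T c0' that N_plus_antimono[OF C, of Z L] unfolding N
    by (auto simp: is_teacher_def intro: order_trans)
  have "{c. is_arg_max (\<lambda>c. prior L c * sample_prob \<beta> (likelihood L c) (T c\<^sub>0))
          (\<lambda>c. c \<in> C') c} = {c\<^sub>0}"
    using T c0' by (simp add: is_teacher_def)
  from unique_arg_max_subset[OF this C(2) c0]
  show "{c. is_arg_max (\<lambda>c. prior (restrict_learner C L) c *
          sample_prob \<beta> (likelihood (restrict_learner C L) c) (T c\<^sub>0)) (\<lambda>c. c \<in> C) c} = {c\<^sub>0}"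
    \<comment> \<open>The simplifier moves the divisor out of the product, giving the form
      \<open>f c / s\<close> that \<open>is_arg_max_divide_pos\<close> rewrites.\<close>
    by (simp add: is_arg_max_divide_pos sum_prior_pos[OF L C])
qed

text \<open>Each teacher serves as its own witness; if \<open>L\<close> has none, the right side is
  an infimum over the empty set, hence \<infinity>.\<close>

lemma MAP_TD_learner_restrict_learner_le:
  assumes "MAP_learner C' Z sat L" "finite C'" "C \<subseteq> C'" "C \<noteq> {}"
  shows "MAP_TD_learner \<alpha> \<beta> C Z (restrict_learner C L) \<le> MAP_TD_learner \<alpha> \<beta> C' Z L"
  unfolding MAP_TD_learner_def
  using assms by (intro INF_mono) (auto intro: is_teacher_restrict_learner teacher_order_mono)

theorem corollary3p6:
  fixes C C' :: "'c set" and Z :: "'z set"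
    and sat sat' :: "'c \<Rightarrow> 'z \<Rightarrow> bool"
    and \<alpha> :: order_mode and \<beta> :: repl_mode
  assumes "concept_class_triple C Z sat"
    and "concept_class_triple C' Z sat'"
    and "C \<subseteq> C'"
    and "\<And>c z. c \<in> C \<Longrightarrow> z \<in> Z \<Longrightarrow> sat c z \<longleftrightarrow> sat' c z"
  shows "MAP_TD \<alpha> \<beta> C Z sat \<le> MAP_TD \<alpha> \<beta> C' Z sat'"
proof -
  \<comment> \<open>\<open>C\<close> is nonempty because it has at least two elements.\<close>
  have C: "finite C'" "C \<subseteq> C'" "C \<noteq> {}"
    using assms(1-3) by (auto simp: concept_class_triple_def)
  show ?thesis
    unfolding MAP_TD_def
  proof (rule INF_mono)
    fix L assume "L \<in> {L. MAP_learner C' Z sat' L}"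
    then have L: "MAP_learner C' Z sat' L" by simp
    \<comment> \<open>The witness is \<open>restrict_learner C L\<close>.\<close>
    show "\<exists>K\<in>{K. MAP_learner C Z sat K}.
        MAP_TD_learner \<alpha> \<beta> C Z K \<le> MAP_TD_learner \<alpha> \<beta> C' Z L"
      using MAP_learner_restrict_learner[OF L C assms(4)]
        MAP_TD_learner_restrict_learner_le[OF L C] by blast
  qed
qed

end
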